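(* Let $n$ be a Deaconescu number all of whose prime divisors are greater than or equal to $11$, and let $p^{*}$ be the smallest prime divisor of $n$. Then $\omega(n) \geq p^{*}$.
   Context: $\phi$ denotes Euler's totient function and $\omega(n)$ denotes the number of distinct prime divisors of $n$. $S_2$ denotes Schemmel's totient function: the multiplicative function on positive integers defined on prime powers ($k \geq 1$) by $S_2(2^k) = 0$ and $S_2(p^k) = p^{k-1}(p-2)$ for primes $p > 2$. A Deaconescu number is a positive composite integer $n \geq 4$ such that $S_2(n) \mid \phi(n) - 1$. *)

theory Defs
  imports "HOL-Number_Theory.Number_Theory"
begin

text \<open>
  Schemmel's totient function \<open>S\<^sub>2\<close>, given as the product of its values on the prime powers
  exactly dividing \<open>n\<close>.  At \<open>p = 2\<close> the factor \<open>p - 2\<close> is \<open>0\<close>, so \<open>S\<^sub>2(2\<^sup>k) = 0\<close> needs no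
  separate case.  Only \<open>n > 0\<close> is meaningful.
\<close>
definition schemmel2 :: "nat \<Rightarrow> nat" where
  "schemmel2 n = (\<Prod>p\<in>prime_factors n. p ^ (multiplicity p n - 1) * (p - 2))"

lemma schemmel2_1: "schemmel2 1 = 1"
  by (simp add: schemmel2_def)

lemma schemmel2_prime_power:
  assumes "prime p" "k \<ge> 1"
  shows "schemmel2 (p ^ k) = p ^ (k - 1) * (p - 2)"
proof -
  have "prime_factors (p ^ k) = {p}"
    using assms by (simp add: prime_factors_power prime_prime_factors)
  moreover have "multiplicity p (p ^ k) = k"
    using assms by (simp add: prime_gt_0_nat multiplicity_same_power)
  ultimately show ?thesis
    by (simp add: schemmel2_def)
qed

lemma schemmel2_mult_coprime:
  assumes "coprime m n" "m > 0" "n > 0"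
  shows "schemmel2 (m * n) = schemmel2 m * schemmel2 n"
proof -
  let ?f = "\<lambda>k p. p ^ (multiplicity p k - 1) * (p - 2 :: nat)"
  have disj: "prime_factors m \<inter> prime_factors n = {}"
  proof (intro equals0I)
    fix p assume "p \<in> prime_factors m \<inter> prime_factors n"
    then have "prime p" "p dvd m" "p dvd n" by (auto simp: in_prime_factors_iff)
    then show False using assms(1) coprime_common_divisor not_prime_unit by blast
  qed
  have mult: "multiplicity p (m * n) = multiplicity p m + multiplicity p n" if "prime p" for p
    using that assms by (simp add: prime_elem_multiplicity_mult_distrib)
  have zero: "multiplicity p k = 0" if "prime p" "p \<notin> prime_factors k" for p k :: nat
    using that by (simp add: prime_factors_multiplicity)
  have "schemmel2 (m * n) = prod (?f (m * n)) (prime_factors m \<union> prime_factors n)"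
    using assms by (simp add: schemmel2_def prime_factors_product)
  also have "\<dots> = prod (?f (m * n)) (prime_factors m) * prod (?f (m * n)) (prime_factors n)"
    using disj by (intro prod.union_disjoint) auto
  also have "prod (?f (m * n)) (prime_factors m) = prod (?f m) (prime_factors m)"
  proof (intro prod.cong refl)
    fix p assume p: "p \<in> prime_factors m"
    then have "multiplicity p n = 0" "prime p" using disj zero[of p n] by auto
    then show "?f (m * n) p = ?f m p" using mult by simp
  qed
  also have "prod (?f (m * n)) (prime_factors n) = prod (?f n) (prime_factors n)"
  proof (intro prod.cong refl)
    fix p assume p: "p \<in> prime_factors n"
    then have "multiplicity p m = 0" "prime p" using disj zero[of p m] by auto
    then show "?f (m * n) p = ?f n p" using mult by simp
  qed
  finally show ?thesis
    by (simp add: schemmel2_def)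
qed

definition deaconescu :: "nat \<Rightarrow> bool" where
  "deaconescu n \<longleftrightarrow> n \<ge> 4 \<and> \<not> prime n \<and> schemmel2 n dvd totient n - 1"

definition omega :: "nat \<Rightarrow> nat" where
  "omega n = card (prime_factors n)"

end

theory Submission
  imports Defs
begin

text \<open>
  Let \<open>A\<close> be the set of prime divisors of \<open>n\<close>, let \<open>k = card A\<close> and let \<open>p\<close> be its least element.
  Both \<open>\<phi>(n)\<close> and \<open>S\<^sub>2(n)\<close> contain the factor \<open>C = n / (\<Prod>q\<in>A. q)\<close>, so \<open>S\<^sub>2(n) dvd \<phi>(n) - 1\<close> forces
  \<open>C = 1\<close>: the number \<open>n\<close> is squarefree, and \<open>k \<ge> 2\<close> because \<open>n\<close> is not prime.  The quotient \<open>M\<close> in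
  \<open>(\<Prod>q\<in>A. q - 1) = M * (\<Prod>q\<in>A. q - 2) + 1\<close> cannot be \<open>0\<close>, nor can it be \<open>1\<close>, since for \<open>k \<ge> 2\<close>
  the two products differ by more than \<open>1\<close>.  Hence \<open>\<phi>(n) / S\<^sub>2(n) > 2\<close>.

  A set of few large primes cannot achieve this.  The inequality
  \<open>((q - 1) / (q - 2))\<^sup>2 \<le> (q - 1) / (q - 3)\<close> turns the square of \<open>\<phi>(n) / S\<^sub>2(n)\<close> into a product of
  \<open>t / (t - 1)\<close> over the distinct integers \<open>t = (q - 1) / 2\<close>, all at least \<open>a = (p - 1) / 2\<close>.  Such a
  product is largest for consecutive integers starting at \<open>a\<close>, where it telescopes to
  \<open>(a - 1 + k) / (a - 1)\<close>.  So \<open>4 < 1 + k / (a - 1)\<close>, that is \<open>k > 3 * (p - 3) / 2\<close>, and the right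
  side exceeds \<open>p\<close> for \<open>p \<ge> 11\<close>.
\<close>

section \<open>The shape of a Deaconescu number\<close>

lemma eq_prod_multiplicity_pred_mult_prod_primes:
  fixes n :: nat
  assumes "n > 0"
  shows "n = (\<Prod>p\<in>prime_factors n. p ^ (multiplicity p n - 1)) * \<Prod>(prime_factors n)"
proof -
  have "n = (\<Prod>p\<in>prime_factors n. p ^ multiplicity p n)"
    using assms by (simp add: prod_prime_factors)
  also have "\<dots> = (\<Prod>p\<in>prime_factors n. p ^ (multiplicity p n - 1) * p)"
    by (intro prod.cong refl power_minus_mult[symmetric])
      (simp add: prime_factors_multiplicity)
  finally show ?thesis
    by (simp add: prod.distrib)
qed

text \<open>
  The part of \<open>n\<close> beyond its radical divides both \<open>\<phi>(n)\<close> and \<open>S\<^sub>2(n)\<close>, hence divides the two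
  consecutive numbers \<open>\<phi>(n) - 1\<close> and \<open>\<phi>(n)\<close>.
\<close>
lemma schemmel2_dvd_totient_pred_imp_radical:
  assumes "n > 0" and "schemmel2 n dvd totient n - 1"
  shows "n = \<Prod>(prime_factors n)"
    and "(\<Prod>p\<in>prime_factors n. p - 2) dvd (\<Prod>p\<in>prime_factors n. p - 1) - 1"
proof -
  define C where "C = (\<Prod>p\<in>prime_factors n. p ^ (multiplicity p n - 1))"
  have tot: "totient n = C * (\<Prod>p\<in>prime_factors n. p - 1)"
    unfolding C_def using assms(1) by (simp add: totient_formula1 prod.distrib)
  have sch: "schemmel2 n = C * (\<Prod>p\<in>prime_factors n. p - 2)"
    unfolding C_def schemmel2_def by (simp add: prod.distrib)
  have "C dvd totient n - 1"
    using assms(2) sch by (metis dvd_mult_left)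
  moreover have "C dvd totient n" using tot by simp
  moreover have "totient n > 0" using assms(1) by simp
  ultimately have "C dvd 1"
    using dvd_diff_nat[of C "totient n" "totient n - 1"] by (simp del: totient_gt_0_iff)
  hence "C = 1" by simp
  with eq_prod_multiplicity_pred_mult_prod_primes[OF assms(1)] tot sch assms(2)
  show "n = \<Prod>(prime_factors n)"
    and "(\<Prod>p\<in>prime_factors n. p - 2) dvd (\<Prod>p\<in>prime_factors n. p - 1) - 1"
    by (simp_all add: C_def)
qed

text \<open>
  Enlarging one factor \<open>q - 2\<close> to \<open>q - 1\<close> already adds the product of the remaining factors, and this
  exceeds \<open>1\<close> once there is at least one remaining factor.
\<close>
lemma prod_minus_two_plus_one_less_prod_minus_one:
  fixes A :: "nat set"
  assumes fin: "finite A" and card: "card A \<ge> 2" and ge: "\<And>q. q \<in> A \<Longrightarrow> q \<ge> 3"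
  shows "(\<Prod>q\<in>A. q - 2) + 1 < (\<Prod>q\<in>A. q - 1)"
proof -
  from card have "A \<noteq> {}" by auto
  then obtain r where r: "r \<in> A" by blast
  define B where "B = A - {r}"
  have B: "finite B" "\<And>q. q \<in> B \<Longrightarrow> q \<ge> 3"
    using fin ge by (auto simp: B_def)
  have "card B > 0"
    using card fin r by (simp add: B_def card_Diff_singleton)
  then obtain s where s: "s \<in> B" by (metis card_gt_0_iff ex_in_conv)
  define X Y where "X = (\<Prod>q\<in>B. q - 1)" and "Y = (\<Prod>q\<in>B. q - 2)"
  have "Y \<le> X"
    unfolding X_def Y_def by (intro prod_mono) auto
  have "X > 0"
    unfolding X_def using B(2) by (intro prod_pos) force
  moreover have "s - 1 dvd X"
    unfolding X_def using B(1) s by (intro dvd_prodI)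
  ultimately have "s - 1 \<le> X"
    by (intro dvd_imp_le)
  with B(2)[OF s] have "X \<ge> 2" by linarith
  have split: "(\<Prod>q\<in>A. q - 1) = (r - 1) * X" "(\<Prod>q\<in>A. q - 2) = (r - 2) * Y"
    unfolding X_def Y_def B_def using fin r by (simp_all add: prod.remove)
  have "(r - 2) * Y + 1 < (r - 2) * X + X"
    using \<open>X \<ge> 2\<close> mult_le_mono2[OF \<open>Y \<le> X\<close>, of "r - 2"] by linarith
  also have "\<dots> = (r - 1) * X"
    using ge[OF r] distrib_right[of "r - 2" 1 X] by (simp add: Suc_diff_Suc numeral_2_eq_2)
  finally show ?thesis
    using split by simp
qed

section \<open>Bounding the quotient of the two products\<close>

text \<open>
  The extremal set consists of the consecutive integers \<open>a, \<dots>, a + card T - 1\<close>, for which the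
  product telescopes.  Removing the largest element, which is at least \<open>a + card T - 1\<close>, compares an
  arbitrary set with this one factor by factor.
\<close>
lemma prod_div_pred_le_telescoped:
  fixes T :: "nat set" and a :: nat
  assumes "finite T" "a \<ge> 2" "\<And>t. t \<in> T \<Longrightarrow> a \<le> t"
  shows "(\<Prod>t\<in>T. real t / (real t - 1)) \<le> (real a - 1 + card T) / (real a - 1)"
  using assms(1,3)
proof (induction T rule: finite_linorder_max_induct)
  case empty
  then show ?case using assms(2) by simp
next
  case (insert m T)
  have "T \<subseteq> {a..<m}" using insert by auto
  hence "card T \<le> m - a"
    using card_mono[of "{a..<m}" T] by simp
  moreover have "a \<le> m" using insert.prems by simp
  ultimately have m: "a + card T \<le> m" by linarith
  have "m \<notin> T" using insert.hyps by auto
  hence "(\<Prod>t\<in>insert m T. real t / (real t - 1))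
      = real m / (real m - 1) * (\<Prod>t\<in>T. real t / (real t - 1))"
    using insert.hyps by simp
  also have "\<dots> \<le> (real a + card T) / (real a + card T - 1) * ((real a - 1 + card T) / (real a - 1))"
  proof (intro mult_mono)
    show "real m / (real m - 1) \<le> (real a + card T) / (real a + card T - 1)"
      using m assms(2) by (simp add: frac_le_eq divide_simps) (simp add: algebra_simps)
    show "(\<Prod>t\<in>T. real t / (real t - 1)) \<le> (real a - 1 + card T) / (real a - 1)"
      using insert by simp
    show "0 \<le> (\<Prod>t\<in>T. real t / (real t - 1))"
      using insert.prems assms(2) by (fastforce intro!: prod_nonneg divide_nonneg_nonneg)
  qed (use assms(2) in auto)
  also have "\<dots> = (real a - 1 + card (insert m T)) / (real a - 1)"
    using assms(2) insert.hyps \<open>m \<notin> T\<close> by (simp add: divide_simps)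
  finally show ?case .
qed

text \<open>
  The square makes the telescoping see that consecutive odd numbers are two apart: it replaces
  \<open>(q - 1) / (q - 2)\<close> by \<open>(q - 1) / (q - 3)\<close>, which is \<open>t / (t - 1)\<close> for \<open>q = 2 * t + 1\<close>.
\<close>
lemma prod_odd_quotient_square_le:
  fixes A :: "nat set" and p :: nat
  assumes fin: "finite A" and odd: "\<And>q. q \<in> A \<Longrightarrow> odd q"
    and "odd p" "p \<ge> 5" and ge: "\<And>q. q \<in> A \<Longrightarrow> p \<le> q"
  shows "(\<Prod>q\<in>A. (real q - 1) / (real q - 2))\<^sup>2 \<le> 1 + 2 * card A / (real p - 3)"
proof -
  obtain a where a: "p = 2 * a + 1" using \<open>odd p\<close> by (rule oddE)
  define h :: "nat \<Rightarrow> nat" where "h = (\<lambda>q. q div 2)"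
  have h: "q = 2 * h q + 1" if "q \<in> A" for q
    using odd[OF that] by (simp add: h_def)
  have inj: "inj_on h A"
    using h by (intro inj_onI) metis
  have h_ge: "a \<le> h q" if "q \<in> A" for q
    using h[OF that] ge[OF that] a by linarith
  have "(\<Prod>q\<in>A. (real q - 1) / (real q - 2))\<^sup>2 = (\<Prod>q\<in>A. ((real q - 1) / (real q - 2))\<^sup>2)"
    by (simp add: prod_power_distrib)
  also have "\<dots> \<le> (\<Prod>q\<in>A. real (h q) / (real (h q) - 1))"
  proof (intro prod_mono conjI)
    fix q assume q: "q \<in> A"
    define x where "x = real (h q)"
    have qx: "real q = 2 * x + 1"
      using arg_cong[OF h[OF q], of real] by (simp add: x_def)
    have x: "x \<ge> 2" using h_ge[OF q] a \<open>p \<ge> 5\<close> by (simp add: x_def)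
    have "x * (2 * x - 1)\<^sup>2 - (2 * x)\<^sup>2 * (x - 1) = x"
      by (simp add: power2_eq_square algebra_simps)
    hence "(2 * x)\<^sup>2 * (x - 1) \<le> x * (2 * x - 1)\<^sup>2" using x by linarith
    hence "(2 * x / (2 * x - 1))\<^sup>2 \<le> x / (x - 1)"
      using x by (simp add: power_divide divide_le_eq le_divide_eq mult.commute)
    thus "((real q - 1) / (real q - 2))\<^sup>2 \<le> real (h q) / (real (h q) - 1)"
      by (simp add: qx flip: x_def)
  qed simp
  also have "\<dots> = (\<Prod>t\<in>h ` A. real t / (real t - 1))"
    using inj by (simp add: prod.reindex)
  also have "\<dots> \<le> (real a - 1 + card (h ` A)) / (real a - 1)"
    using fin h_ge a \<open>p \<ge> 5\<close> by (intro prod_div_pred_le_telescoped) auto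
  also have "\<dots> = 1 + 2 * card A / (real p - 3)"
    using a \<open>p \<ge> 5\<close> inj by (simp add: card_image divide_simps) (simp add: algebra_simps)
  finally show ?thesis .
qed

section \<open>The number of prime divisors of a Deaconescu number\<close>

theorem lemma2p1:
  fixes n :: nat
  assumes "deaconescu n"
    and "\<And>p. prime p \<Longrightarrow> p dvd n \<Longrightarrow> p \<ge> 11"
  shows "omega n \<ge> Min {p. prime p \<and> p dvd n}"
proof -
  define A where "A = prime_factors n"
  have n: "n \<ge> 4" "\<not> prime n" "schemmel2 n dvd totient n - 1"
    using assms(1) by (auto simp: deaconescu_def)
  have A: "{p. prime p \<and> p dvd n} = A"
    using n(1) by (auto simp: A_def prime_factors_dvd)
  have fin: "finite A" by (simp add: A_def)
  have prime_A: "prime q" and ge11: "q \<ge> 11" if "q \<in> A" for q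
    using that assms(2) A by auto
  have radical: "n = \<Prod>A" and dvd: "(\<Prod>q\<in>A. q - 2) dvd (\<Prod>q\<in>A. q - 1) - 1"
    using schemmel2_dvd_totient_pred_imp_radical[of n] n by (auto simp: A_def)
  have "card A \<noteq> 0" using radical n(1) fin by auto
  moreover have "card A \<noteq> 1"
    using radical n(2) prime_A by (auto simp: card_1_singleton_iff)
  ultimately have card: "card A \<ge> 2" by linarith

  define P Q where "P = (\<Prod>q\<in>A. q - 1)" and "Q = (\<Prod>q\<in>A. q - 2)"
  have "Q > 0" unfolding Q_def using ge11 by (fastforce intro!: prod_pos)
  have "Q + 1 < P"
    unfolding P_def Q_def using fin card ge11
    by (intro prod_minus_two_plus_one_less_prod_minus_one) force+
  obtain M where M: "P - 1 = Q * M"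
    using dvd by (auto simp: P_def Q_def)
  have "M \<noteq> 0" using M \<open>Q + 1 < P\<close> by (cases "M = 0") simp_all
  moreover have "M \<noteq> 1" using M \<open>Q + 1 < P\<close> by auto
  ultimately have "Q * 2 \<le> Q * M" by (intro mult_le_mono2) linarith
  hence PQ: "2 * Q < P" using M \<open>Q + 1 < P\<close> by linarith

  define p where "p = Min A"
  have "p \<in> A" using card fin unfolding p_def by (intro Min_in) auto
  have p_le: "p \<le> q" if "q \<in> A" for q using that fin by (simp add: p_def)
  have odd: "odd q" if "q \<in> A" for q
    using prime_A[OF that] ge11[OF that] by (intro prime_odd_nat) auto
  have "2 < real P / real Q"
    using PQ \<open>Q > 0\<close> by (simp add: less_divide_eq flip: of_nat_mult)
  also have "real P / real Q = (\<Prod>q\<in>A. (real q - 1) / (real q - 2))"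
    unfolding P_def Q_def of_nat_prod prod_dividef[symmetric]
    using ge11 by (intro prod.cong refl) fastforce
  finally have "2\<^sup>2 < (\<Prod>q\<in>A. (real q - 1) / (real q - 2))\<^sup>2"
    by (intro power_strict_mono) auto
  also have "\<dots> \<le> 1 + 2 * card A / (real p - 3)"
    using fin odd p_le ge11[OF \<open>p \<in> A\<close>] odd[OF \<open>p \<in> A\<close>]
    by (intro prod_odd_quotient_square_le) auto
  finally have "3 * (real p - 3) < 2 * card A"
    using ge11[OF \<open>p \<in> A\<close>] by (simp add: less_divide_eq)
  hence "real p \<le> real (card A)" using ge11[OF \<open>p \<in> A\<close>] by simp
  hence "p \<le> card A" by simp
  thus ?thesis
    unfolding A by (simp add: p_def omega_def A_def)
qed

end
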